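(* Write $\Theta_n=\{\phi_1,\dots,\phi_s\}$ and for $k=1,\dots,m$ let $I_k,J_k\subseteq\{1,\dots,s\}$ and $r_k=\frac{\bigvee_{i\in I_k}\phi_i\vee\bigvee_{j\in J_k}\phi_j}{\bigvee_{j\in J_k}\phi_j}$. There is a single substitution $\sigma$ rejecting each of $r_1,\dots,r_m$ in $S4$ iff there is a set $W$ with $W\subseteq\{\phi_i\in\Theta_n\mid i\in I_k\cup J_k\}$ for every $k=1,\dots,m$, such that (1) for each $k=1,\dots,m$, $\phi_i\in W$ for some $i\in I_k$; (2) $\mathcal M(\Theta_n,W),\phi_j\models\phi_j$ for all $\phi_j\in W$; (3) for each subset $D$ of $W$ there exists $\phi_j\in W$ such that $\theta_\diamond(\phi_j)=\theta(\phi_j)\cup\bigcup_{\phi\in D}\theta_\diamond(\phi)$.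
   Context: $S4$ is the normal modal logic with axioms $K$, $T:\Box A\to A$, $4:\Box A\to\Box\Box A$ and necessitation; $\diamond=\neg\Box\neg$. A substitution $\sigma$ rejects a rule $\frac{\alpha}{\beta}$ if $\vdash_{S4}\sigma(\alpha)$ and $\nvdash_{S4}\sigma(\beta)$. Fix variables $p_1,\dots,p_n$; $\alpha^1=\alpha$, $\alpha^0=\neg\alpha$. $\Theta_n$ is the set of all disjuncts $\bigwedge_{i=1}^n p_i^{t(i,0)}\wedge\bigwedge_{i=1}^n(\diamond p_i)^{t(i,1)}$, $t:\{1,\dots,n\}\times\{0,1\}\to\{0,1\}$. For such $\phi$, $\theta(\phi)=\{p_i\mid t(i,0)=1\}$, $\theta_\diamond(\phi)=\{p_i\mid t(i,1)=1\}$. For $W\subseteq\Theta_n$, $\mathcal M(\Theta_n,W)$ is the Kripke model with worlds $W$, $\phi R\psi$ iff $\theta_\diamond(\psi)\subseteq\theta_\diamond(\phi)$, and $p_i$ true at $\phi$ iff $p_i\in\theta(\phi)$.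
   Formalization: The sets I_k and J_k are assumed disjoint for each k; without this the claim fails, e.g. for n = m = 1 and I_1 = J_1 = {1,...,s}, where W = {p∧◇p, ¬p∧◇p, ¬p∧¬◇p} satisfies (1)-(3) but no substitution rejects r_1. *)

theory Defs
  imports Main
begin

datatype fm = Var nat | Fls | Imp fm fm | Box fm

definition Neg :: "fm \<Rightarrow> fm" where "Neg A = Imp A Fls"
definition Tru :: fm where "Tru = Neg Fls"
definition Disj :: "fm \<Rightarrow> fm \<Rightarrow> fm" where "Disj A B = Imp (Neg A) B"
definition Conj :: "fm \<Rightarrow> fm \<Rightarrow> fm" where "Conj A B = Neg (Imp A (Neg B))"
definition Dia :: "fm \<Rightarrow> fm" where "Dia A = Neg (Box (Neg A))"

definition BigConj :: "fm list \<Rightarrow> fm" where "BigConj As = foldr Conj As Tru"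
definition BigDisj :: "fm list \<Rightarrow> fm" where "BigDisj As = foldr Disj As Fls"

definition IDisj :: "nat set \<Rightarrow> (nat \<Rightarrow> fm) \<Rightarrow> fm" where
  "IDisj I f = BigDisj (map f (sorted_list_of_set I))"

text \<open>A propositional valuation treats variables and boxed formulas as atoms, so that
  \<open>taut\<close> describes the modal substitution instances of classical tautologies.\<close>

primrec peval :: "(fm \<Rightarrow> bool) \<Rightarrow> fm \<Rightarrow> bool" where
  "peval v (Var x) = v (Var x)"
| "peval v Fls = False"
| "peval v (Imp A B) = (peval v A \<longrightarrow> peval v B)"
| "peval v (Box A) = v (Box A)"

definition taut :: "fm \<Rightarrow> bool" where "taut A \<longleftrightarrow> (\<forall>v. peval v A)"

inductive S4 :: "fm \<Rightarrow> bool" where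
  Taut: "taut A \<Longrightarrow> S4 A"
| AxK: "S4 (Imp (Box (Imp A B)) (Imp (Box A) (Box B)))"
| AxT: "S4 (Imp (Box A) A)"
| Ax4: "S4 (Imp (Box A) (Box (Box A)))"
| MP: "S4 (Imp A B) \<Longrightarrow> S4 A \<Longrightarrow> S4 B"
| Nec: "S4 A \<Longrightarrow> S4 (Box A)"

primrec subst :: "(nat \<Rightarrow> fm) \<Rightarrow> fm \<Rightarrow> fm" where
  "subst \<sigma> (Var x) = \<sigma> x"
| "subst \<sigma> Fls = Fls"
| "subst \<sigma> (Imp A B) = Imp (subst \<sigma> A) (subst \<sigma> B)"
| "subst \<sigma> (Box A) = Box (subst \<sigma> A)"

text \<open>A rule is the pair of its premise and its conclusion.\<close>

definition rejects :: "(nat \<Rightarrow> fm) \<Rightarrow> fm \<times> fm \<Rightarrow> bool" where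
  "rejects \<sigma> r \<longleftrightarrow> S4 (subst \<sigma> (fst r)) \<and> \<not> S4 (subst \<sigma> (snd r))"

record 'w kripke =
  worlds :: "'w set"
  acc :: "'w \<Rightarrow> 'w \<Rightarrow> bool"
  val :: "'w \<Rightarrow> nat \<Rightarrow> bool"

primrec sat :: "'w kripke \<Rightarrow> 'w \<Rightarrow> fm \<Rightarrow> bool" where
  "sat M w (Var x) = val M w x"
| "sat M w Fls = False"
| "sat M w (Imp A B) = (sat M w A \<longrightarrow> sat M w B)"
| "sat M w (Box A) = (\<forall>u\<in>worlds M. acc M w u \<longrightarrow> sat M u A)"

definition lit :: "fm \<Rightarrow> bool \<Rightarrow> fm" where
  "lit A b = (if b then A else Neg A)"

text \<open>The variables $p_1, \dots, p_n$ are \<open>Var 1\<close>, ..., \<open>Var n\<close>, among countably many variables.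
  The set $\{0,1\}$ is rendered by \<open>bool\<close>; the values of \<open>t\<close> at indices outside
  \<open>{1..n}\<close> are not used.\<close>

definition disjunct :: "nat \<Rightarrow> (nat \<times> bool \<Rightarrow> bool) \<Rightarrow> fm" where
  "disjunct n t =
     Conj (BigConj (map (\<lambda>i. lit (Var i) (t (i, False))) [1..<Suc n]))
          (BigConj (map (\<lambda>i. lit (Dia (Var i)) (t (i, True))) [1..<Suc n]))"

definition Theta :: "nat \<Rightarrow> fm set" where
  "Theta n = {disjunct n t | t. True}"

text \<open>A disjunct determines \<open>t\<close> on the relevant indices, see \<open>theta_disjunct\<close> and
  \<open>theta_dia_disjunct\<close> below. Variables are represented by their indices.\<close>

definition theta :: "nat \<Rightarrow> fm \<Rightarrow> nat set" where
  "theta n \<phi> = {i \<in> {1..n}. \<exists>t. \<phi> = disjunct n t \<and> t (i, False)}"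

definition theta_dia :: "nat \<Rightarrow> fm \<Rightarrow> nat set" where
  "theta_dia n \<phi> = {i \<in> {1..n}. \<exists>t. \<phi> = disjunct n t \<and> t (i, True)}"

lemma lit_inject: "lit A b = lit A c \<longleftrightarrow> b = c"
proof -
  have "size (Neg A) > size A" by (simp add: Neg_def)
  then have "Neg A \<noteq> A" by (metis less_irrefl)
  then show ?thesis unfolding lit_def by (metis (full_types))
qed

lemma BigConj_map_inject:
  "BigConj (map f xs) = BigConj (map g xs) \<longleftrightarrow> (\<forall>x\<in>set xs. f x = g x)"
  by (induction xs) (auto simp: BigConj_def Conj_def Neg_def)

lemma disjunct_inject:
  "disjunct n t = disjunct n u \<longleftrightarrow> (\<forall>i\<in>{1..n}. \<forall>b. t (i, b) = u (i, b))"
proof -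
  have "Conj A B = Conj C D \<longleftrightarrow> A = C \<and> B = D" for A B C D
    by (auto simp: Conj_def Neg_def)
  moreover have "set [1..<Suc n] = {1..n}" by auto
  ultimately show ?thesis
    unfolding disjunct_def by (simp only: BigConj_map_inject lit_inject all_bool_eq) blast
qed

lemma theta_disjunct: "theta n (disjunct n t) = {i \<in> {1..n}. t (i, False)}"
  unfolding theta_def disjunct_inject by blast

lemma theta_dia_disjunct: "theta_dia n (disjunct n t) = {i \<in> {1..n}. t (i, True)}"
  unfolding theta_dia_def disjunct_inject by blast

definition model :: "nat \<Rightarrow> fm set \<Rightarrow> fm kripke" where
  "model n W = \<lparr>worlds = W,
     acc = (\<lambda>\<phi> \<psi>. theta_dia n \<psi> \<subseteq> theta_dia n \<phi>),
     val = (\<lambda>\<phi> i. i \<in> theta n \<phi>)\<rparr>"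

end

theory Submission
  imports Defs
begin

text \<open>
  Every world of the canonical model of S4, with \<open>p\<^sub>i\<close> read as \<open>\<sigma>(p\<^sub>i)\<close>, satisfies exactly one
  element of \<open>\<Theta>\<^sub>n\<close>, its type. A substitution rejects \<open>r\<^sub>k\<close> iff the set of its types is contained in
  \<open>I\<^sub>k \<union> J\<^sub>k\<close> and meets \<open>I\<^sub>k\<close>, so it remains to show that the sets of types are the sets \<open>W\<close>
  with (2) and (3). Sets of types satisfy (3) because a new root can be put below any set of
  worlds. Conversely, given \<open>W\<close>, keep the canonical valuation on the worlds all of whose
  successors have types in \<open>W\<close>, and enlarge this region in rounds: a world whose successors outside
  the region all see the same set \<open>D\<close> of types inside it receives the variables of a type
  that (3) provides for \<open>D\<close>. Finitely many rounds exhaust the model, and every round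
  is definable by modal formulas, which gives the substitution.
\<close>

section \<open>Completeness of S4\<close>

lemma sat_connectives [simp]:
  "sat M w (Neg A) \<longleftrightarrow> \<not> sat M w A"
  "sat M w (Conj A B) \<longleftrightarrow> sat M w A \<and> sat M w B"
  "sat M w (Disj A B) \<longleftrightarrow> sat M w A \<or> sat M w B"
  "sat M w (Dia A) \<longleftrightarrow> (\<exists>u\<in>worlds M. acc M w u \<and> sat M u A)"
  "sat M w Tru"
  by (auto simp: Neg_def Conj_def Disj_def Dia_def Tru_def)

lemma sat_BigConj [simp]: "sat M w (BigConj As) \<longleftrightarrow> (\<forall>A\<in>set As. sat M w A)"
  by (induction As) (auto simp: BigConj_def)

lemma sat_BigDisj [simp]: "sat M w (BigDisj As) \<longleftrightarrow> (\<exists>A\<in>set As. sat M w A)"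
  by (induction As) (auto simp: BigDisj_def)

section \<open>Soundness over reflexive transitive models\<close>

definition preorder_model :: "'w kripke \<Rightarrow> bool" where
  "preorder_model M \<longleftrightarrow> (\<forall>w\<in>worlds M. acc M w w) \<and>
     (\<forall>u\<in>worlds M. \<forall>v\<in>worlds M. \<forall>w\<in>worlds M. acc M u v \<longrightarrow> acc M v w \<longrightarrow> acc M u w)"

lemma preorder_model_refl: "preorder_model M \<Longrightarrow> w \<in> worlds M \<Longrightarrow> acc M w w"
  by (simp add: preorder_model_def)

lemma preorder_model_trans:
  "preorder_model M \<Longrightarrow> acc M u v \<Longrightarrow> acc M v w \<Longrightarrow>
    u \<in> worlds M \<Longrightarrow> v \<in> worlds M \<Longrightarrow> w \<in> worlds M \<Longrightarrow> acc M u w"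
  unfolding preorder_model_def by blast

text \<open>Variables and boxed formulas are atoms for \<open>peval\<close>, so truth at a world is
  itself a propositional valuation. This is why tautologies hold at every world.\<close>

lemma peval_sat: "peval (sat M w) A = sat M w A"
  by (induction A) auto

lemma soundness:
  assumes "S4 A" "preorder_model M" "w \<in> worlds M"
  shows "sat M w A"
  using assms(1,3)
proof (induction arbitrary: w)
  case (Taut A)
  then show ?case using peval_sat[of M w A] by (simp add: taut_def)
next
  case (Ax4 A)
  then show ?case using preorder_model_trans[OF assms(2)] by auto
qed (simp_all add: preorder_model_refl[OF assms(2)])

section \<open>Propositional reasoning in S4 and derivability from premises\<close>

lemma peval_foldr_Imp:
  "peval v (foldr Imp As B) \<longleftrightarrow> ((\<forall>A\<in>set As. peval v A) \<longrightarrow> peval v B)"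
  by (induction As) auto

lemma S4_foldr_MP: "S4 (foldr Imp As B) \<Longrightarrow> \<forall>A\<in>set As. S4 A \<Longrightarrow> S4 B"
  by (induction As) (auto intro: S4.MP)

text \<open>Premise lists become iterated implications, which reduces each propositional step to a
  check of valuations.\<close>

lemma S4_taut_consequence: "taut (foldr Imp As B) \<Longrightarrow> \<forall>A\<in>set As. S4 A \<Longrightarrow> S4 B"
  using S4_foldr_MP S4.Taut by blast

text \<open>The last premise can be moved into the conclusion, so the induction hypothesis, stated
  for every conclusion, applies; axiom K then distributes the box.\<close>

lemma S4_foldr_Box: "S4 (foldr Imp As A) \<Longrightarrow> S4 (foldr Imp (map Box As) (Box A))"
proof (induction As arbitrary: A rule: rev_induct)
  case Nil
  then show ?case by (simp add: S4.Nec)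
next
  case (snoc B As)
  then have "S4 (foldr Imp (map Box As) (Box (Imp B A)))" by simp
  moreover have "S4 (Imp (Box (Imp B A)) (Imp (Box B) (Box A)))" by (rule S4.AxK)
  ultimately show ?case
    by (intro S4_taut_consequence[of "[foldr Imp (map Box As) (Box (Imp B A)),
          Imp (Box (Imp B A)) (Imp (Box B) (Box A))]"])
       (auto simp: taut_def peval_foldr_Imp)
qed

text \<open>Necessitation acts on theorems only, never on premises; otherwise the deduction theorem
  \<open>derives_deduction\<close> would fail.\<close>

definition derives :: "fm set \<Rightarrow> fm \<Rightarrow> bool" where
  "derives \<Gamma> A \<longleftrightarrow> (\<exists>As. set As \<subseteq> \<Gamma> \<and> S4 (foldr Imp As A))"

lemma derives_assumption: "A \<in> \<Gamma> \<Longrightarrow> derives \<Gamma> A"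
  unfolding derives_def
  by (rule exI[of _ "[A]"]) (auto intro!: S4.Taut simp: taut_def)

lemma derives_taut: "taut A \<Longrightarrow> derives \<Gamma> A"
  unfolding derives_def by (rule exI[of _ "[]"]) (auto intro: S4.Taut)

lemma derives_MP:
  assumes "derives \<Gamma> (Imp A B)" "derives \<Gamma> A"
  shows "derives \<Gamma> B"
proof -
  obtain As Bs where "set As \<subseteq> \<Gamma>" "S4 (foldr Imp As (Imp A B))"
    "set Bs \<subseteq> \<Gamma>" "S4 (foldr Imp Bs A)"
    using assms by (auto simp: derives_def)
  moreover from this have "S4 (foldr Imp (As @ Bs) B)"
    by (intro S4_taut_consequence[of "[foldr Imp As (Imp A B), foldr Imp Bs A]"])
       (auto simp: taut_def peval_foldr_Imp simp del: foldr_append)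
  ultimately show ?thesis unfolding derives_def by (intro exI[of _ "As @ Bs"]) auto
qed

lemma derives_deduction:
  assumes "derives (insert A \<Gamma>) B"
  shows "derives \<Gamma> (Imp A B)"
proof -
  obtain As where As: "set As \<subseteq> insert A \<Gamma>" "S4 (foldr Imp As B)"
    using assms by (auto simp: derives_def)
  have "S4 (foldr Imp (filter (\<lambda>C. C \<noteq> A) As) (Imp A B))"
    by (rule S4_taut_consequence[of "[foldr Imp As B]"])
       (use As(2) in \<open>auto simp: taut_def peval_foldr_Imp\<close>)
  then show ?thesis
    unfolding derives_def using As(1) by (intro exI[of _ "filter (\<lambda>C. C \<noteq> A) As"]) auto
qed

section \<open>Maximal consistent sets\<close>

definition max_consistent :: "fm set \<Rightarrow> bool" where
  "max_consistent \<Gamma> \<longleftrightarrow> \<not> derives \<Gamma> Fls \<and> (\<forall>A. A \<notin> \<Gamma> \<longrightarrow> derives (insert A \<Gamma>) Fls)"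

text \<open>Zorn's lemma applies because a derivation uses finitely many premises, and these all lie
  in one member of a nonempty chain.\<close>

lemma max_consistent_extension:
  assumes "\<not> derives \<Gamma> Fls"
  obtains \<Delta> where "max_consistent \<Delta>" "\<Gamma> \<subseteq> \<Delta>"
proof -
  let ?S = "{\<Delta>. \<Gamma> \<subseteq> \<Delta> \<and> \<not> derives \<Delta> Fls}"
  have "\<exists>\<Delta>\<in>?S. \<forall>X\<in>?S. \<Delta> \<subseteq> X \<longrightarrow> X = \<Delta>"
  proof (rule subset_Zorn_nonempty)
    show "?S \<noteq> {}" using assms by blast
  next
    fix \<C> assume ne: "\<C> \<noteq> {}" and chain: "subset.chain ?S \<C>"
    have "\<not> derives (\<Union>\<C>) Fls"
    proof
      assume "derives (\<Union>\<C>) Fls"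
      then obtain As where As: "set As \<subseteq> \<Union>\<C>" "S4 (foldr Imp As Fls)"
        by (auto simp: derives_def)
      obtain \<Delta> where "\<Delta> \<in> \<C>" "set As \<subseteq> \<Delta>"
        using finite_subset_Union_chain[OF _ As(1) ne chain] by blast
      then have "\<Delta> \<in> ?S" "derives \<Delta> Fls"
        using chain As(2) by (auto simp: subset.chain_def derives_def)
      then show False by simp
    qed
    moreover have "\<Gamma> \<subseteq> \<Union>\<C>" using ne chain by (fastforce simp: subset.chain_def)
    ultimately show "\<Union>\<C> \<in> ?S" by simp
  qed
  then obtain \<Delta> where \<Delta>: "\<Delta> \<in> ?S" "\<forall>X\<in>?S. \<Delta> \<subseteq> X \<longrightarrow> X = \<Delta>" ..
  have "derives (insert A \<Delta>) Fls" if "A \<notin> \<Delta>" for A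
    using \<Delta>(1) bspec[OF \<Delta>(2), of "insert A \<Delta>"] that by blast
  then show ?thesis using that[of \<Delta>] \<Delta>(1) by (simp add: max_consistent_def)
qed

lemma max_consistent_closed:
  assumes "max_consistent \<Gamma>" "derives \<Gamma> A"
  shows "A \<in> \<Gamma>"
proof (rule ccontr)
  assume "A \<notin> \<Gamma>"
  then have "derives \<Gamma> (Imp A Fls)"
    using assms(1) by (auto simp: max_consistent_def intro: derives_deduction)
  then show False using assms derives_MP by (auto simp: max_consistent_def)
qed

lemma max_consistent_Fls: "max_consistent \<Gamma> \<Longrightarrow> Fls \<notin> \<Gamma>"
  using derives_assumption by (auto simp: max_consistent_def)

lemma max_consistent_Imp:
  assumes "max_consistent \<Gamma>"
  shows "Imp A B \<in> \<Gamma> \<longleftrightarrow> (A \<in> \<Gamma> \<longrightarrow> B \<in> \<Gamma>)"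
proof
  assume "Imp A B \<in> \<Gamma>"
  then show "A \<in> \<Gamma> \<longrightarrow> B \<in> \<Gamma>"
    using max_consistent_closed[OF assms] derives_MP derives_assumption by blast
next
  assume AB: "A \<in> \<Gamma> \<longrightarrow> B \<in> \<Gamma>"
  show "Imp A B \<in> \<Gamma>"
  proof (cases "B \<in> \<Gamma>")
    case True
    have "derives \<Gamma> (Imp B (Imp A B))" by (rule derives_taut) (simp add: taut_def)
    then show ?thesis
      using True max_consistent_closed[OF assms] derives_MP derives_assumption by blast
  next
    case False
    then have "derives \<Gamma> (Imp A Fls)"
      using AB assms by (auto simp: max_consistent_def intro: derives_deduction)
    moreover have "derives \<Gamma> (Imp (Imp A Fls) (Imp A B))"
      by (rule derives_taut) (simp add: taut_def)
    ultimately show ?thesis using max_consistent_closed[OF assms] derives_MP by blast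
  qed
qed

lemma max_consistent_S4: "max_consistent \<Gamma> \<Longrightarrow> S4 A \<Longrightarrow> A \<in> \<Gamma>"
  by (rule max_consistent_closed) (auto simp: derives_def intro: exI[of _ "[]"])

section \<open>The canonical model\<close>

definition canonical :: "fm set kripke" where
  "canonical = \<lparr>worlds = {\<Gamma>. max_consistent \<Gamma>},
     acc = (\<lambda>\<Gamma> \<Delta>. \<forall>A. Box A \<in> \<Gamma> \<longrightarrow> A \<in> \<Delta>),
     val = (\<lambda>\<Gamma> i. Var i \<in> \<Gamma>)\<rparr>"

text \<open>Axiom T gives reflexivity and axiom 4 gives transitivity.\<close>

lemma preorder_model_canonical: "preorder_model canonical"
proof -
  have T: "A \<in> \<Gamma>" if "max_consistent \<Gamma>" "Box A \<in> \<Gamma>" for \<Gamma> A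
    using that(2) max_consistent_S4[OF that(1) S4.AxT[of A]] max_consistent_Imp[OF that(1)] by simp
  have 4: "Box (Box A) \<in> \<Gamma>" if "max_consistent \<Gamma>" "Box A \<in> \<Gamma>" for \<Gamma> A
    using that(2) max_consistent_S4[OF that(1) S4.Ax4[of A]] max_consistent_Imp[OF that(1)] by simp
  show ?thesis
    unfolding preorder_model_def canonical_def kripke.simps using T 4 by blast
qed

text \<open>If \<open>Neg A\<close> were inconsistent with the formulas boxed in
  \<open>\<Gamma>\<close>, boxing a finite derivation of \<open>A\<close> would put
  \<open>Box A\<close> into \<open>\<Gamma>\<close>.\<close>

lemma max_consistent_Box_witness:
  assumes "max_consistent \<Gamma>" "Box A \<notin> \<Gamma>"
  obtains \<Delta> where "max_consistent \<Delta>" "\<forall>B. Box B \<in> \<Gamma> \<longrightarrow> B \<in> \<Delta>" "A \<notin> \<Delta>"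
proof -
  let ?\<Delta> = "insert (Neg A) {B. Box B \<in> \<Gamma>}"
  have "\<not> derives ?\<Delta> Fls"
  proof
    assume "derives ?\<Delta> Fls"
    then have "derives {B. Box B \<in> \<Gamma>} (Imp (Neg A) Fls)" by (rule derives_deduction)
    moreover have "derives {B. Box B \<in> \<Gamma>} (Imp (Imp (Neg A) Fls) A)"
      by (rule derives_taut) (simp add: taut_def Neg_def)
    ultimately have "derives {B. Box B \<in> \<Gamma>} A" using derives_MP by blast
    then obtain As where "set As \<subseteq> {B. Box B \<in> \<Gamma>}" "S4 (foldr Imp As A)"
      by (auto simp: derives_def)
    then have "set (map Box As) \<subseteq> \<Gamma>" "S4 (foldr Imp (map Box As) (Box A))"
      using S4_foldr_Box by auto
    then have "derives \<Gamma> (Box A)" unfolding derives_def by blast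
    then show False using max_consistent_closed assms by blast
  qed
  then obtain \<Delta> where \<Delta>: "max_consistent \<Delta>" "?\<Delta> \<subseteq> \<Delta>"
    by (rule max_consistent_extension)
  then have "Imp A Fls \<in> \<Delta>" by (simp add: Neg_def)
  then have "A \<notin> \<Delta>" using \<Delta>(1) max_consistent_Imp max_consistent_Fls by blast
  then show ?thesis using that \<Delta> by blast
qed

lemma truth_lemma: "\<Gamma> \<in> worlds canonical \<Longrightarrow> sat canonical \<Gamma> A \<longleftrightarrow> A \<in> \<Gamma>"
proof (induction A arbitrary: \<Gamma>)
  case (Box A)
  then have \<Gamma>: "max_consistent \<Gamma>" by (simp add: canonical_def)
  have "(\<forall>\<Delta>\<in>worlds canonical. acc canonical \<Gamma> \<Delta> \<longrightarrow> A \<in> \<Delta>) \<longleftrightarrow> Box A \<in> \<Gamma>"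
    using max_consistent_Box_witness[OF \<Gamma>, of A] by (auto simp: canonical_def)
  then show ?case using Box.IH by simp
qed (auto simp: canonical_def max_consistent_Fls max_consistent_Imp)

text \<open>One fixed model decides provability of all formulas, so a substitution can be studied
  through the valuation it induces there.\<close>

theorem completeness: "S4 A \<longleftrightarrow> (\<forall>w\<in>worlds canonical. sat canonical w A)"
proof
  show "\<forall>w\<in>worlds canonical. sat canonical w A" if "S4 A"
    using soundness[OF that preorder_model_canonical] by blast
next
  assume valid: "\<forall>w\<in>worlds canonical. sat canonical w A"
  show "S4 A"
  proof (rule ccontr)
    assume "\<not> S4 A"
    have "\<not> derives {Neg A} Fls"
    proof
      assume "derives {Neg A} Fls"
      then have "derives {} (Imp (Neg A) Fls)" by (rule derives_deduction)
      then have "S4 (Imp (Neg A) Fls)" by (auto simp: derives_def)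
      then have "S4 A"
        by (intro S4_taut_consequence[of "[Imp (Neg A) Fls]"]) (auto simp: taut_def Neg_def)
      then show False using \<open>\<not> S4 A\<close> by contradiction
    qed
    then obtain \<Delta> where \<Delta>: "max_consistent \<Delta>" "{Neg A} \<subseteq> \<Delta>"
      by (rule max_consistent_extension)
    then have "\<Delta> \<in> worlds canonical" by (simp add: canonical_def)
    then have "sat canonical \<Delta> (Neg A)"
      using truth_lemma \<Delta>(2) by blast
    then show False using valid \<open>\<Delta> \<in> worlds canonical\<close> by simp
  qed
qed

text \<open>By soundness \<open>Neg A\<close> is not provable, and completeness turns this into a
  canonical world. The lemma carries worlds of auxiliary preorders into the canonical model.\<close>

lemma canonical_realises:
  assumes "preorder_model M" "w \<in> worlds M" "sat M w A"
  obtains u where "u \<in> worlds canonical" "sat canonical u A"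
proof -
  have "\<not> S4 (Neg A)" using soundness[OF _ assms(1,2), of "Neg A"] assms(3) by auto
  then show ?thesis using that completeness[of "Neg A"] by auto
qed

section \<open>Types of worlds\<close>

definition ty :: "nat \<Rightarrow> 'w kripke \<Rightarrow> 'w \<Rightarrow> fm" where
  "ty n M w = disjunct n
     (\<lambda>(i, b). if b then \<exists>u\<in>worlds M. acc M w u \<and> val M u i else val M w i)"

lemma ty_in_Theta [simp]: "ty n M w \<in> Theta n"
  by (auto simp: ty_def Theta_def)

lemma theta_ty: "theta n (ty n M w) = {i \<in> {1..n}. val M w i}"
  by (simp add: ty_def theta_disjunct)

lemma theta_dia_ty:
  "theta_dia n (ty n M w) = {i \<in> {1..n}. \<exists>u\<in>worlds M. acc M w u \<and> val M u i}"
  by (simp add: ty_def theta_dia_disjunct)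

lemma Theta_eqI:
  assumes "\<phi> \<in> Theta n" "\<psi> \<in> Theta n"
    "theta n \<phi> = theta n \<psi>" "theta_dia n \<phi> = theta_dia n \<psi>"
  shows "\<phi> = \<psi>"
proof -
  obtain t u where tu: "\<phi> = disjunct n t" "\<psi> = disjunct n u"
    using assms(1,2) by (auto simp: Theta_def)
  have "t (i, b) = u (i, b)" if "i \<in> {1..n}" for i b
  proof -
    have "i \<in> theta n \<phi> \<longleftrightarrow> i \<in> theta n \<psi>" "i \<in> theta_dia n \<phi> \<longleftrightarrow> i \<in> theta_dia n \<psi>"
      using assms(3,4) by simp_all
    then show ?thesis
      using that unfolding tu theta_disjunct theta_dia_disjunct by (cases b) simp_all
  qed
  then show ?thesis unfolding tu disjunct_inject by blast
qed

text \<open>A disjunct prescribes the truth value of every \<open>Var i\<close> and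
  \<open>Dia (Var i)\<close> with \<open>i\<close> in \<open>{1..n}\<close>, so it holds exactly
  where the prescription is the actual one.\<close>

lemma sat_Theta_iff:
  assumes "\<phi> \<in> Theta n"
  shows "sat M w \<phi> \<longleftrightarrow> \<phi> = ty n M w"
proof -
  obtain t where t: "\<phi> = disjunct n t" using assms by (auto simp: Theta_def)
  have "sat M w (lit A b) \<longleftrightarrow> sat M w A = b" for A b by (simp add: lit_def)
  moreover have "set [1..<Suc n] = {1..n}" by auto
  ultimately show ?thesis
    unfolding t ty_def disjunct_inject all_bool_eq
    by (auto simp: disjunct_def simp del: set_upt)
qed

lemma theta_subset: "theta n \<psi> \<subseteq> {1..n}" and theta_dia_subset: "theta_dia n \<psi> \<subseteq> {1..n}"
  by (auto simp: theta_def theta_dia_def)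

section \<open>Substitutions as changes of valuation\<close>

definition pull :: "'w kripke \<Rightarrow> (nat \<Rightarrow> fm) \<Rightarrow> 'w kripke" where
  "pull M \<sigma> = M\<lparr>val := \<lambda>w i. sat M w (\<sigma> i)\<rparr>"

lemma pull_simps [simp]:
  "worlds (pull M \<sigma>) = worlds M" "acc (pull M \<sigma>) = acc M"
  "val (pull M \<sigma>) w i = sat M w (\<sigma> i)"
  by (simp_all add: pull_def)

lemma sat_subst: "sat M w (subst \<sigma> A) = sat (pull M \<sigma>) w A"
  by (induction A arbitrary: w) auto

definition types :: "nat \<Rightarrow> (nat \<Rightarrow> fm) \<Rightarrow> fm set" where
  "types n \<sigma> = ty n (pull canonical \<sigma>) ` worlds canonical"

lemma sat_IDisj:
  assumes "finite I" "\<phi> ` I \<subseteq> Theta n"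
  shows "sat M w (IDisj I \<phi>) \<longleftrightarrow> ty n M w \<in> \<phi> ` I"
proof -
  have "sat M w (\<phi> i) \<longleftrightarrow> ty n M w = \<phi> i" if "i \<in> I" for i
    using sat_Theta_iff[of "\<phi> i" n M w] assms(2) that by (metis image_subset_iff)
  then show ?thesis using assms(1) by (auto simp: IDisj_def image_iff)
qed

lemma S4_IDisj_iff:
  assumes "finite I" "\<phi> ` I \<subseteq> Theta n"
  shows "S4 (subst \<sigma> (IDisj I \<phi>)) \<longleftrightarrow> types n \<sigma> \<subseteq> \<phi> ` I"
  unfolding completeness sat_subst sat_IDisj[OF assms] types_def by blast

text \<open>A disjunction over an index set is true at a world iff it lists the type of that world,
  so the conclusion is unprovable iff some realised type is missing from it.\<close>

lemma rejects_iff: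
  assumes "finite I" "\<phi> ` I \<subseteq> Theta n" "finite J" "\<phi> ` J \<subseteq> Theta n"
  shows "rejects \<sigma> (Disj (IDisj I \<phi>) (IDisj J \<phi>), IDisj J \<phi>) \<longleftrightarrow>
    types n \<sigma> \<subseteq> \<phi> ` (I \<union> J) \<and> \<not> types n \<sigma> \<subseteq> \<phi> ` J"
proof -
  have "S4 (subst \<sigma> (Disj (IDisj I \<phi>) (IDisj J \<phi>))) \<longleftrightarrow> types n \<sigma> \<subseteq> \<phi> ` (I \<union> J)"
    unfolding completeness sat_subst sat_connectives sat_IDisj[OF assms(1,2)]
      sat_IDisj[OF assms(3,4)] types_def by blast
  then show ?thesis by (simp add: rejects_def S4_IDisj_iff[OF assms(3,4)])
qed

text \<open>By \<open>sat_Theta_iff\<close>, condition (2) asks every \<open>\<psi>\<close> in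
  \<open>W\<close> to equal the type computed here.\<close>

lemma ty_model: 
  "ty n (model n W) \<psi> = disjunct n (\<lambda>(i, b). if b
     then \<exists>\<chi>\<in>W. theta_dia n \<chi> \<subseteq> theta_dia n \<psi> \<and> i \<in> theta n \<chi> else i \<in> theta n \<psi>)"
  by (simp add: ty_def model_def)

lemma preorder_model_model: "preorder_model (model n W)"
  by (auto simp: preorder_model_def model_def)

section \<open>From substitutions to sets of types\<close>

text \<open>A diamond in \<open>model n (types n \<sigma>)\<close> is already in
  \<open>\<psi>\<close>, because canonical reflexivity puts the variables of a type among its
  diamonds. Conversely, a canonical successor witnessing a diamond of \<open>\<psi>\<close> has, by
  transitivity, a type that \<open>\<psi>\<close> sees in the model.\<close>

lemma types_self_satisfied:
  assumes "\<psi> \<in> types n \<sigma>"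
  shows "sat (model n (types n \<sigma>)) \<psi> \<psi>"
proof -
  let ?C = "pull canonical \<sigma>"
  note refl = preorder_model_refl[OF preorder_model_canonical]
    and trans = preorder_model_trans[OF preorder_model_canonical]
  obtain w where w: "w \<in> worlds canonical" "\<psi> = ty n ?C w"
    using assms by (auto simp: types_def)
  let ?M = "model n (types n \<sigma>)"
  have "theta n (ty n ?M \<psi>) = theta n \<psi>"
    using theta_subset[of n \<psi>] by (auto simp: ty_model theta_disjunct)
  moreover have "theta_dia n (ty n ?M \<psi>) = theta_dia n \<psi>"
  proof
    show "theta_dia n (ty n ?M \<psi>) \<subseteq> theta_dia n \<psi>"
    proof
      fix i assume "i \<in> theta_dia n (ty n ?M \<psi>)"
      then obtain u where u: "u \<in> worlds canonical"
        "theta_dia n (ty n ?C u) \<subseteq> theta_dia n \<psi>" "i \<in> theta n (ty n ?C u)"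
        by (auto simp: ty_model theta_dia_disjunct types_def)
      then have "i \<in> theta_dia n (ty n ?C u)"
        using refl by (auto simp: theta_ty theta_dia_ty)
      then show "i \<in> theta_dia n \<psi>" using u(2) by blast
    qed
    show "theta_dia n \<psi> \<subseteq> theta_dia n (ty n ?M \<psi>)"
    proof
      fix i assume "i \<in> theta_dia n \<psi>"
      then obtain u where u: "u \<in> worlds canonical" "acc canonical w u"
        "sat canonical u (\<sigma> i)" "i \<in> {1..n}"
        by (auto simp: w(2) theta_dia_ty)
      have "theta_dia n (ty n ?C u) \<subseteq> theta_dia n \<psi>"
        using trans[OF u(2)] u(1) w by (auto simp: theta_dia_ty)
      moreover have "i \<in> theta n (ty n ?C u)" "ty n ?C u \<in> types n \<sigma>"
        using u by (auto simp: theta_ty types_def)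
      ultimately show "i \<in> theta_dia n (ty n ?M \<psi>)"
        using u(4) by (auto simp: ty_model theta_dia_disjunct)
    qed
  qed
  ultimately have "\<psi> = ty n ?M \<psi>" using w(2) by (intro Theta_eqI[of _ n]) auto
  then show ?thesis using w(2) sat_Theta_iff[of \<psi> n ?M \<psi>] by simp
qed

text \<open>Letting the root see all successors of members of \<open>S\<close> keeps the relation
  transitive. No old world sees the root, so truth at old worlds is unchanged.\<close>

definition add_root :: "'w set \<Rightarrow> 'w kripke \<Rightarrow> 'w option kripke" where
  "add_root S M = \<lparr>worlds = insert None (Some ` worlds M),
     acc = (\<lambda>x y. case (x, y) of
         (None, None) \<Rightarrow> True
       | (None, Some u) \<Rightarrow> \<exists>d\<in>S. acc M d u
       | (Some w, None) \<Rightarrow> False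
       | (Some w, Some u) \<Rightarrow> acc M w u),
     val = (\<lambda>x i. case x of None \<Rightarrow> False | Some w \<Rightarrow> val M w i)\<rparr>"

lemma sat_add_root: "sat (add_root S M) (Some w) A = sat M w A"
  by (induction A arbitrary: w) (auto simp: add_root_def)

lemma preorder_model_add_root:
  assumes "preorder_model M" "S \<subseteq> worlds M"
  shows "preorder_model (add_root S M)"
  using preorder_model_refl[OF assms(1)] preorder_model_trans[OF assms(1)] assms(2)
  by (auto simp: preorder_model_def add_root_def split: option.splits) (metis subsetD)+

text \<open>A root added below worlds realising \<open>D\<close> has a type with the required
  diamonds. The extended model is not canonical, so this type has to be carried back.\<close>

lemma types_extension:
  assumes "D \<subseteq> types n \<sigma>"
  shows "\<exists>\<psi>\<in>types n \<sigma>. theta_dia n \<psi> = theta n \<psi> \<union> (\<Union>\<chi>\<in>D. theta_dia n \<chi>)"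
proof -
  let ?C = "pull canonical \<sigma>"
  obtain S where S: "S \<subseteq> worlds canonical" "D = ty n ?C ` S"
    using assms unfolding types_def by (meson subset_imageE)
  define E where "E = add_root S canonical"
  define \<psi> where "\<psi> = ty n (pull E \<sigma>) None"
  have E: "preorder_model E"
    unfolding E_def using preorder_model_canonical S(1) by (rule preorder_model_add_root)
  have None: "None \<in> worlds E" by (simp add: E_def add_root_def)
  \<comment> \<open>Having type \<open>\<psi>\<close> under the valuation induced by
    \<open>\<sigma>\<close> is expressed by the single formula \<open>subst \<sigma> \<psi>\<close>,
    which can be realised canonically.\<close>
  have "sat E None (subst \<sigma> \<psi>)"
    by (simp add: sat_subst sat_Theta_iff[of _ n] \<psi>_def)
  then obtain w where "w \<in> worlds canonical" "sat canonical w (subst \<sigma> \<psi>)"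
    by (rule canonical_realises[OF E None])
  then have "\<psi> \<in> types n \<sigma>"
    by (auto simp: sat_subst sat_Theta_iff[of _ n] \<psi>_def types_def)
  \<comment> \<open>The two alternatives yield the two parts of the union in (3): variables true at
    the root itself, and diamonds inherited from \<open>S\<close>.\<close>
  moreover have succ: "(\<exists>u\<in>worlds E. acc E None u \<and> P u) \<longleftrightarrow>
      P None \<or> (\<exists>d\<in>S. \<exists>u\<in>worlds canonical. acc canonical d u \<and> P (Some u))" for P
    by (auto simp: E_def add_root_def)
  have "theta_dia n \<psi> = theta n \<psi> \<union> (\<Union>\<chi>\<in>D. theta_dia n \<chi>)"
    unfolding \<psi>_def S(2) theta_ty theta_dia_ty pull_simps succ
    by (auto simp: theta_dia_ty E_def sat_add_root)
  ultimately show ?thesis by blast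
qed

section \<open>From sets of types to substitutions\<close>

definition definable :: "'w kripke \<Rightarrow> ('w \<Rightarrow> bool) \<Rightarrow> bool" where
  "definable M P \<longleftrightarrow> (\<exists>A. \<forall>w\<in>worlds M. sat M w A = P w)"

lemma definable_sat: "definable M (\<lambda>w. sat M w A)"
  by (auto simp: definable_def)

lemma definable_cong: "definable M P \<Longrightarrow> (\<And>w. w \<in> worlds M \<Longrightarrow> P w = Q w) \<Longrightarrow> definable M Q"
  unfolding definable_def by metis

lemma definable_const: "definable M (\<lambda>w. b)"
  unfolding definable_def by (rule exI[of _ "if b then Tru else Fls"]) auto

lemma definable_not: "definable M P \<Longrightarrow> definable M (\<lambda>w. \<not> P w)"
  unfolding definable_def by (metis sat_connectives(1))

lemma definable_conj:
  "definable M P \<Longrightarrow> definable M Q \<Longrightarrow> definable M (\<lambda>w. P w \<and> Q w)"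
  unfolding definable_def by (metis sat_connectives(2))

lemma definable_disj:
  "definable M P \<Longrightarrow> definable M Q \<Longrightarrow> definable M (\<lambda>w. P w \<or> Q w)"
  unfolding definable_def by (metis sat_connectives(3))

lemma definable_iff:
  "definable M P \<Longrightarrow> definable M Q \<Longrightarrow> definable M (\<lambda>w. P w \<longleftrightarrow> Q w)"
  unfolding iff_conv_conj_imp imp_conv_disj
  by (intro definable_conj definable_disj definable_not)

lemma definable_Box:
  assumes "definable M P"
  shows "definable M (\<lambda>w. \<forall>u\<in>worlds M. acc M w u \<longrightarrow> P u)"
proof -
  obtain A where "\<forall>w\<in>worlds M. sat M w A = P w" using assms by (auto simp: definable_def)
  then show ?thesis unfolding definable_def by (intro exI[of _ "Box A"]) auto
qed

lemma definable_Dia: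
  assumes "definable M P"
  shows "definable M (\<lambda>w. \<exists>u\<in>worlds M. acc M w u \<and> P u)"
  using definable_not[OF definable_Box[OF definable_not[OF assms]]] by simp

lemma definable_Ball:
  "finite X \<Longrightarrow> (\<And>x. x \<in> X \<Longrightarrow> definable M (P x)) \<Longrightarrow> definable M (\<lambda>w. \<forall>x\<in>X. P x w)"
  by (induction rule: finite_induct) (auto intro: definable_const definable_conj)

lemma definable_Bex:
  "finite X \<Longrightarrow> (\<And>x. x \<in> X \<Longrightarrow> definable M (P x)) \<Longrightarrow> definable M (\<lambda>w. \<exists>x\<in>X. P x w)"
  by (induction rule: finite_induct) (auto intro: definable_const definable_disj)

text \<open>A type is fixed by finitely many truth values of variables and their diamonds, so
  definability passes from the valuation to the type.\<close>

lemma definable_ty: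
  assumes "\<And>i. definable M (\<lambda>w. v w i)" "\<phi> \<in> Theta n"
  shows "definable M (\<lambda>w. ty n (M\<lparr>val := v\<rparr>) w = \<phi>)"
proof -
  have "ty n (M\<lparr>val := v\<rparr>) w = \<phi> \<longleftrightarrow> (\<forall>i\<in>{1..n}. v w i = (i \<in> theta n \<phi>)) \<and>
      (\<forall>i\<in>{1..n}. (\<exists>u\<in>worlds M. acc M w u \<and> v u i) = (i \<in> theta_dia n \<phi>))" for w
  proof -
    have "ty n (M\<lparr>val := v\<rparr>) w = \<phi> \<longleftrightarrow> theta n (ty n (M\<lparr>val := v\<rparr>) w) = theta n \<phi> \<and>
       theta_dia n (ty n (M\<lparr>val := v\<rparr>) w) = theta_dia n \<phi>"
      by (metis Theta_eqI assms(2) ty_in_Theta)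
    then show ?thesis
      using theta_subset[of n \<phi>] theta_dia_subset[of n \<phi>]
      unfolding theta_ty theta_dia_ty by (auto simp: subset_eq set_eq_iff)
  qed
  then show ?thesis
    by (simp only:) (intro definable_conj definable_Ball definable_iff definable_Dia
        definable_const assms(1) finite_atLeastAtMost)
qed

section \<open>Growing the region in rounds\<close>

definition seen_types :: "nat \<Rightarrow> 'w kripke \<Rightarrow> ('w \<Rightarrow> bool) \<Rightarrow> 'w \<Rightarrow> fm set" where
  "seen_types n M g w = {ty n M u | u. u \<in> worlds M \<and> acc M w u \<and> g u}"

text \<open>
  The state of the iteration: \<open>g\<close> is the region in which the valuation \<open>v\<close> already gives every
  world a type in \<open>W\<close>. A world left outside after \<open>k\<close> rounds sees at least \<open>k\<close> types in the
  region, so that the region is everything after \<open>card W + 1\<close> rounds, without any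
  well-foundedness assumption on \<open>M\<close>.
\<close>

definition stage :: "nat \<Rightarrow> fm set \<Rightarrow> 'w kripke \<Rightarrow> nat \<Rightarrow> ('w \<Rightarrow> bool) \<Rightarrow> ('w \<Rightarrow> nat \<Rightarrow> bool) \<Rightarrow> bool"
  where
  "stage n W M k g v \<longleftrightarrow>
     definable M g \<and> (\<forall>i. definable M (\<lambda>w. v w i)) \<and>
     (\<forall>w\<in>worlds M. \<forall>u\<in>worlds M. acc M w u \<longrightarrow> g w \<longrightarrow> g u) \<and>
     (\<forall>w\<in>worlds M. g w \<longrightarrow> ty n (M\<lparr>val := v\<rparr>) w \<in> W) \<and>
     (\<forall>w\<in>worlds M. \<not> g w \<longrightarrow> k \<le> card (seen_types n (M\<lparr>val := v\<rparr>) g w)) \<and>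
     (\<forall>w\<in>worlds M. (\<forall>u\<in>worlds M. acc M w u \<longrightarrow> ty n M u \<in> W) \<longrightarrow>
        g w \<and> ty n (M\<lparr>val := v\<rparr>) w = ty n M w)"

text \<open>The valuation is unchanged, so the last clause of \<open>stage\<close> is immediate. The
  region is definable because membership in the finite set \<open>W\<close> is a finite
  disjunction.\<close>

lemma stage_0:
  assumes "preorder_model M" "finite W" "W \<subseteq> Theta n"
  shows "stage n W M 0 (\<lambda>w. \<forall>u\<in>worlds M. acc M w u \<longrightarrow> ty n M u \<in> W) (val M)"
proof -
  have val: "definable M (\<lambda>w. val M w i)" for i
    using definable_sat[of M "Var i"] by simp
  have M: "M\<lparr>val := val M\<rparr> = M" by simp
  have "definable M (\<lambda>u. \<exists>\<phi>\<in>W. ty n M u = \<phi>)"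
    using definable_ty[of M "val M" _ n] val assms(2,3) unfolding M
    by (intro definable_Bex) auto
  then have "definable M (\<lambda>u. ty n M u \<in> W)" by simp
  then show ?thesis
    unfolding stage_def M
    using val definable_Box preorder_model_refl[OF assms(1)] preorder_model_trans[OF assms(1)]
    by auto
qed

text \<open>A world joins the region when its outside successors all see the same types in the
  region as it does; (3) supplies a type fitting that set. Any other outside world has an outside
  successor that sees strictly fewer types, which raises the bound by one.\<close>

lemma stage_Suc:
  assumes M: "preorder_model M" and W: "finite W" "W \<subseteq> Theta n"
    and ext: "\<forall>D \<subseteq> W. \<exists>\<psi>\<in>W. theta_dia n \<psi> = theta n \<psi> \<union> (\<Union>\<chi>\<in>D. theta_dia n \<chi>)"
    and st: "stage n W M k g v"
  shows "\<exists>g' v'. stage n W M (Suc k) g' v'"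
proof -
  note refl = preorder_model_refl[OF M] and trans = preorder_model_trans[OF M]
  define N where "N = M\<lparr>val := v\<rparr>"
  have N [simp]: "worlds N = worlds M" "acc N = acc M" "val N = v"
    by (simp_all add: N_def)
  have g: "definable M g" and v: "\<And>i. definable M (\<lambda>w. v w i)"
    and up: "\<And>w u. w \<in> worlds M \<Longrightarrow> u \<in> worlds M \<Longrightarrow> acc M w u \<Longrightarrow> g w \<Longrightarrow> g u"
    and tyW: "\<And>w. w \<in> worlds M \<Longrightarrow> g w \<Longrightarrow> ty n N w \<in> W"
    and cardk: "\<And>w. w \<in> worlds M \<Longrightarrow> \<not> g w \<Longrightarrow> k \<le> card (seen_types n N g w)"
    and start: "\<And>w. w \<in> worlds M \<Longrightarrow> \<forall>u\<in>worlds M. acc M w u \<longrightarrow> ty n M u \<in> W \<Longrightarrow>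
        g w \<and> ty n N w = ty n M w"
    using st unfolding stage_def N_def by blast+
  define D where "D = seen_types n N g"
  have D_sub: "D w \<subseteq> W" for w using tyW by (auto simp: D_def seen_types_def)
  have D_antimono: "D u \<subseteq> D w" if "w \<in> worlds M" "u \<in> worlds M" "acc M w u" for w u
    using trans[OF that(3)] that by (fastforce simp: D_def seen_types_def)
  obtain \<psi> where \<psi>: "\<And>X. X \<subseteq> W \<Longrightarrow> \<psi> X \<in> W"
    "\<And>X. X \<subseteq> W \<Longrightarrow> theta_dia n (\<psi> X) = theta n (\<psi> X) \<union> (\<Union>\<chi>\<in>X. theta_dia n \<chi>)"
    using ext by metis
  define g' where "g' w \<longleftrightarrow> g w \<or> (\<forall>u\<in>worlds M. acc M w u \<longrightarrow> g u \<or> D u = D w)" for w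
  \<comment> \<open>Values are assigned on everything outside \<open>g\<close>, even outside
    \<open>g'\<close>; the next round overwrites those left over.\<close>
  define v' where "v' w i \<longleftrightarrow> (if g w then v w i else i \<in> theta n (\<psi> (D w)))" for w i
  define N' where "N' = M\<lparr>val := v'\<rparr>"
  have N' [simp]: "worlds N' = worlds M" "acc N' = acc M" "val N' = v'"
    by (simp_all add: N'_def)

  \<comment> \<open>Since \<open>D w\<close> lies in the finite set \<open>W\<close>, it can be
    compared with \<open>X\<close> one type at a time.\<close>
  have def_D: "definable M (\<lambda>w. D w = X)" if "X \<subseteq> W" for X
  proof -
    have "definable M (\<lambda>w. \<forall>\<phi>\<in>W. (\<exists>u\<in>worlds M. acc M w u \<and> g u \<and> ty n N u = \<phi>) \<longleftrightarrow> \<phi> \<in> X)"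
      unfolding N_def using W
      by (intro definable_Ball definable_iff definable_Dia definable_conj definable_ty
          definable_const g v) auto
    moreover have "(\<exists>u\<in>worlds M. acc M w u \<and> g u \<and> ty n N u = \<phi>) \<longleftrightarrow> \<phi> \<in> D w" for w \<phi>
      by (auto simp: D_def seen_types_def)
    ultimately have "definable M (\<lambda>w. \<forall>\<phi>\<in>W. \<phi> \<in> D w \<longleftrightarrow> \<phi> \<in> X)" by simp
    moreover have "(\<forall>\<phi>\<in>W. \<phi> \<in> D w \<longleftrightarrow> \<phi> \<in> X) \<longleftrightarrow> D w = X" for w
      using that D_sub[of w] by blast
    ultimately show ?thesis by simp
  qed
  have fin: "finite (Pow W)" using W(1) by simp
  have def_g': "definable M g'"
  proof -
    \<comment> \<open>The box in \<open>g'\<close> refers back to \<open>D w\<close>. Guessing this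
      value among the finitely many subsets of \<open>W\<close> leaves a fixed \<open>X\<close>
      under the box.\<close>
    have "definable M (\<lambda>w. g w \<or>
        (\<exists>X\<in>Pow W. D w = X \<and> (\<forall>u\<in>worlds M. acc M w u \<longrightarrow> g u \<or> D u = X)))"
      by (intro definable_disj definable_Bex definable_conj definable_Box def_D g fin) auto
    then show ?thesis by (rule definable_cong) (use D_sub in \<open>auto simp: g'_def\<close>)
  qed
  have def_v': "definable M (\<lambda>w. v' w i)" for i
  proof -
    have "definable M (\<lambda>w. (g w \<and> v w i) \<or>
        (\<not> g w \<and> (\<exists>X\<in>Pow W. D w = X \<and> i \<in> theta n (\<psi> X))))"
      by (intro definable_disj definable_Bex definable_conj definable_not definable_const
          def_D g v fin) auto
    then show ?thesis by (rule definable_cong) (use D_sub in \<open>auto simp: v'_def\<close>)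
  qed
  have up': "g' u" if "w \<in> worlds M" "u \<in> worlds M" "acc M w u" "g' w" for w u
    using that up trans[OF that(3)] unfolding g'_def by metis
  have ty_old: "ty n N' w = ty n N w" if "w \<in> worlds M" "g w" for w
  proof (rule Theta_eqI[of _ n])
    show "theta n (ty n N' w) = theta n (ty n N w)"
      using that by (simp add: theta_ty v'_def)
    \<comment> \<open>The region is closed under successors, so a type inside it never depends on
      the values changed outside.\<close>
    have "v' u = v u" if "u \<in> worlds M" "acc M w u" for u
      using up \<open>w \<in> worlds M\<close> \<open>g w\<close> that by (auto simp: v'_def)
    then show "theta_dia n (ty n N' w) = theta_dia n (ty n N w)"
      by (auto simp: theta_dia_ty)
  qed auto
  \<comment> \<open>Successors in \<open>g\<close> contribute the union over \<open>D w\<close>.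
    Outside successors share \<open>D w\<close> and thus carry the variables of
    \<open>\<psi> (D w)\<close>, which by reflexivity are also witnessed at
    \<open>w\<close>.\<close>
  have ty_new: "ty n N' w = \<psi> (D w)" if w: "w \<in> worlds M" "g' w" "\<not> g w" for w
  proof (rule Theta_eqI[of _ n])
    show "\<psi> (D w) \<in> Theta n" using \<psi>(1) D_sub W(2) by blast
    show "theta n (ty n N' w) = theta n (\<psi> (D w))"
      using w theta_subset[of n "\<psi> (D w)"] by (auto simp: theta_ty v'_def)
    show "theta_dia n (ty n N' w) = theta_dia n (\<psi> (D w))"
    proof
      show "theta_dia n (ty n N' w) \<subseteq> theta_dia n (\<psi> (D w))"
      proof
        fix i assume "i \<in> theta_dia n (ty n N' w)"
        then obtain u where u: "u \<in> worlds M" "acc M w u" "v' u i" "i \<in> {1..n}"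
          by (auto simp: theta_dia_ty)
        show "i \<in> theta_dia n (\<psi> (D w))"
        proof (cases "g u")
          case True
          then have "ty n N u \<in> D w" "i \<in> theta_dia n (ty n N u)"
            using u refl by (auto simp: D_def seen_types_def theta_dia_ty v'_def)
          then show ?thesis using \<psi>(2)[OF D_sub] by blast
        next
          case False
          then have "D u = D w" using u w by (auto simp: g'_def)
          then show ?thesis using \<psi>(2)[OF D_sub] u False by (auto simp: v'_def)
        qed
      qed
      show "theta_dia n (\<psi> (D w)) \<subseteq> theta_dia n (ty n N' w)"
      proof
        fix i assume i: "i \<in> theta_dia n (\<psi> (D w))"
        then have n: "i \<in> {1..n}" using theta_dia_subset by blast
        from i consider "i \<in> theta n (\<psi> (D w))"
          | u where "u \<in> worlds M" "acc M w u" "g u" "i \<in> theta_dia n (ty n N u)"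
          unfolding \<psi>(2)[OF D_sub] by (auto simp: D_def seen_types_def)
        then show "i \<in> theta_dia n (ty n N' w)"
        proof cases
          case 1
          then have "v' w i" using w by (simp add: v'_def)
          then show ?thesis using n w(1) refl by (auto simp: theta_dia_ty)
        next
          case 2
          then obtain x where x: "x \<in> worlds M" "acc M u x" "v x i"
            by (auto simp: theta_dia_ty)
          then have "v' x i" using up[of u x] 2 by (simp add: v'_def)
          moreover have "acc M w x" using trans[OF 2(2) x(2)] w 2 x by blast
          ultimately show ?thesis using n x(1) by (auto simp: theta_dia_ty)
        qed
      qed
    qed
  qed auto
  have tyW': "ty n N' w \<in> W" if "w \<in> worlds M" "g' w" for w
    using that ty_old ty_new tyW \<psi>(1)[OF D_sub] by (cases "g w") auto
  have card': "Suc k \<le> card (seen_types n N' g' w)" if w: "w \<in> worlds M" "\<not> g' w" for w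
  proof -
    \<comment> \<open>The old bound is applied to this successor \<open>u\<close>, not to
      \<open>w\<close>: the strict inclusion of \<open>D u\<close> in \<open>D w\<close> gives the
      extra one.\<close>
    obtain u where u: "u \<in> worlds M" "acc M w u" "\<not> g u" "D u \<noteq> D w"
      using w by (auto simp: g'_def)
    have "D u \<subset> D w" using D_antimono[of w u] u w by auto
    then have "card (D u) < card (D w)"
      using D_sub W(1) by (meson psubset_card_mono finite_subset)
    moreover have "D w \<subseteq> seen_types n N' g' w"
      using ty_old by (force simp: D_def seen_types_def g'_def)
    moreover have "finite (seen_types n N' g' w)"
      by (rule finite_subset[OF _ W(1)]) (use tyW' in \<open>auto simp: seen_types_def\<close>)
    ultimately show ?thesis
      using cardk[OF u(1,3)] card_mono[of "seen_types n N' g' w" "D w"]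
      by (simp add: D_def)
  qed
  have start': "g' w \<and> ty n N' w = ty n M w"
    if "w \<in> worlds M" "\<forall>u\<in>worlds M. acc M w u \<longrightarrow> ty n M u \<in> W" for w
    using start[OF that] ty_old[OF that(1)] by (auto simp: g'_def)
  have "stage n W M (Suc k) g' v'"
    unfolding stage_def N'_def[symmetric]
    using def_g' def_v' up' tyW' card' start' by blast
  then show ?thesis by blast
qed

lemma stage_exists:
  assumes "preorder_model M" "finite W" "W \<subseteq> Theta n"
    and "\<forall>D \<subseteq> W. \<exists>\<psi>\<in>W. theta_dia n \<psi> = theta n \<psi> \<union> (\<Union>\<chi>\<in>D. theta_dia n \<chi>)"
  shows "\<exists>g v. stage n W M k g v"
proof (induction k)
  case 0
  show ?case using stage_0[OF assms(1-3)] by blast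
next
  case (Suc k)
  then show ?case using stage_Suc[OF assms] by blast
qed

text \<open>Once the region is everything, all types lie in \<open>W\<close>. That each member of
  \<open>W\<close> occurs comes from the worlds that the last clause of \<open>stage\<close>
  protects throughout the rounds.\<close>

lemma types_surjective:
  assumes W: "finite W" "W \<subseteq> Theta n"
    and self: "\<forall>\<psi>\<in>W. sat (model n W) \<psi> \<psi>"
    and ext: "\<forall>D \<subseteq> W. \<exists>\<psi>\<in>W. theta_dia n \<psi> = theta n \<psi> \<union> (\<Union>\<chi>\<in>D. theta_dia n \<chi>)"
  obtains \<sigma> where "types n \<sigma> = W"
proof -
  let ?C = canonical
  obtain g v where st: "stage n W ?C (Suc (card W)) g v"
    using stage_exists[OF preorder_model_canonical W ext] by blast
  \<comment> \<open>Definability of the final valuation supplies the formula that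
    \<open>\<sigma>\<close> assigns to each variable.\<close>
  have "\<forall>i. \<exists>A. \<forall>w\<in>worlds ?C. sat ?C w A = v w i"
    using st unfolding stage_def definable_def by blast
  then obtain \<sigma> where \<sigma>: "\<And>i w. w \<in> worlds ?C \<Longrightarrow> sat ?C w (\<sigma> i) = v w i" by metis
  let ?N = "?C\<lparr>val := v\<rparr>"
  have ty_eq: "ty n (pull ?C \<sigma>) w = ty n ?N w" if "w \<in> worlds ?C" for w
    by (rule Theta_eqI[of _ n]) (use that \<sigma> in \<open>auto simp: theta_ty theta_dia_ty\<close>)
  have tyW: "\<forall>w\<in>worlds ?C. g w \<longrightarrow> ty n ?N w \<in> W"
    using st unfolding stage_def by (elim conjE) assumption
  have g: "g w" if w: "w \<in> worlds ?C" for w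
  proof (rule ccontr)
    assume "\<not> g w"
    then have "Suc (card W) \<le> card (seen_types n ?N g w)"
      using st w unfolding stage_def by blast
    moreover have "seen_types n ?N g w \<subseteq> W"
      unfolding seen_types_def using tyW by auto
    ultimately show False using card_mono[OF W(1)] by (meson Suc_n_not_le_n le_trans)
  qed
  then have "types n \<sigma> \<subseteq> W"
    unfolding types_def using tyW ty_eq by auto
  moreover have "\<psi> \<in> types n \<sigma>" if \<psi>: "\<psi> \<in> W" for \<psi>
  proof -
    obtain Ws where Ws: "set Ws = W" using W(1) finite_list by blast
    \<comment> \<open>By (2) every world of \<open>model n W\<close> satisfies itself, so the
      formula saying that the type is \<open>\<psi>\<close> and all successors have types in
      \<open>W\<close> holds at \<open>\<psi>\<close>.\<close>
    have "sat (model n W) \<psi> (Conj \<psi> (Box (BigDisj Ws)))"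
      using self \<psi> by (auto simp: Ws model_def)
    moreover have "\<psi> \<in> worlds (model n W)" using \<psi> by (simp add: model_def)
    ultimately obtain w where w: "w \<in> worlds ?C" "sat ?C w (Conj \<psi> (Box (BigDisj Ws)))"
      using canonical_realises[OF preorder_model_model] by blast
    have "ty n ?C w = \<psi>" using w(2) sat_Theta_iff \<psi> W(2) by fastforce
    moreover have "ty n ?C u \<in> W" if u: "u \<in> worlds ?C" "acc ?C w u" for u
    proof -
      obtain A where "A \<in> W" "sat ?C u A" using w(2) u by (auto simp: Ws)
      then show ?thesis using sat_Theta_iff[of A n ?C u] W(2) by auto
    qed
    ultimately have "ty n ?N w = \<psi>" using st w(1) unfolding stage_def by blast
    then have "\<psi> = ty n (pull ?C \<sigma>) w" using ty_eq[OF w(1)] by simp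
    then show ?thesis unfolding types_def using w(1) by (rule image_eqI)
  qed
  ultimately show ?thesis using that by blast
qed

section \<open>Characterisation of joint rejection\<close>

theorem theorem3p8:
  fixes n m s :: nat
    and \<phi> :: "nat \<Rightarrow> fm"
    and I J :: "nat \<Rightarrow> nat set"
    and r :: "nat \<Rightarrow> fm \<times> fm"
  assumes "bij_betw \<phi> {1..s} (Theta n)"
    and "\<forall>k\<in>{1..m}. I k \<subseteq> {1..s} \<and> J k \<subseteq> {1..s}"
    and "\<forall>k\<in>{1..m}. I k \<inter> J k = {}"
    and "\<forall>k\<in>{1..m}. r k = (Disj (IDisj (I k) \<phi>) (IDisj (J k) \<phi>), IDisj (J k) \<phi>)"
  shows "(\<exists>\<sigma>. \<forall>k\<in>{1..m}. rejects \<sigma> (r k)) \<longleftrightarrow>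
    (\<exists>W \<subseteq> Theta n.
       (\<forall>k\<in>{1..m}. W \<subseteq> {\<phi> i | i. i \<in> I k \<union> J k}) \<and>
       (\<forall>k\<in>{1..m}. \<exists>i\<in>I k. \<phi> i \<in> W) \<and>
       (\<forall>\<psi>\<in>W. sat (model n W) \<psi> \<psi>) \<and>
       (\<forall>D \<subseteq> W. \<exists>\<psi>\<in>W. theta_dia n \<psi> = theta n \<psi> \<union> (\<Union>\<chi>\<in>D. theta_dia n \<chi>)))"
proof -
  have inj: "inj_on \<phi> {1..s}" and img: "\<phi> ` {1..s} = Theta n"
    using assms(1) by (auto simp: bij_betw_def)
  have fin: "finite (Theta n)" using img by (metis finite_atLeastAtMost finite_imageI)
  have rej: "rejects \<sigma> (r k) \<longleftrightarrow>
      types n \<sigma> \<subseteq> {\<phi> i | i. i \<in> I k \<union> J k} \<and> (\<exists>i\<in>I k. \<phi> i \<in> types n \<sigma>)"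
    if k: "k \<in> {1..m}" for \<sigma> k
  proof -
    have sub: "I k \<subseteq> {1..s}" "J k \<subseteq> {1..s}" using assms(2) k by auto
    have "rejects \<sigma> (r k) \<longleftrightarrow>
        types n \<sigma> \<subseteq> \<phi> ` (I k \<union> J k) \<and> \<not> types n \<sigma> \<subseteq> \<phi> ` J k"
      using rejects_iff[of "I k" \<phi> n "J k"] assms(4) k sub img
      by (metis finite_atLeastAtMost finite_subset image_mono)
    \<comment> \<open>For types contained in the union, avoiding the image of \<open>J k\<close>
      means lying in the image of \<open>I k\<close>, since the two images are disjoint.\<close>
    moreover have "\<phi> ` I k \<inter> \<phi> ` J k = {}"
      using inj_on_image_Int[OF inj sub] assms(3) k by simp
    moreover have "{\<phi> i | i. i \<in> I k \<union> J k} = \<phi> ` I k \<union> \<phi> ` J k" by blast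
    ultimately show ?thesis unfolding image_Un by blast
  qed
  show ?thesis
  proof
    assume "\<exists>\<sigma>. \<forall>k\<in>{1..m}. rejects \<sigma> (r k)"
    then obtain \<sigma> where "\<forall>k\<in>{1..m}. rejects \<sigma> (r k)" by blast
    moreover have "types n \<sigma> \<subseteq> Theta n" by (auto simp: types_def)
    ultimately show "\<exists>W \<subseteq> Theta n.
       (\<forall>k\<in>{1..m}. W \<subseteq> {\<phi> i | i. i \<in> I k \<union> J k}) \<and>
       (\<forall>k\<in>{1..m}. \<exists>i\<in>I k. \<phi> i \<in> W) \<and>
       (\<forall>\<psi>\<in>W. sat (model n W) \<psi> \<psi>) \<and>
       (\<forall>D \<subseteq> W. \<exists>\<psi>\<in>W. theta_dia n \<psi> = theta n \<psi> \<union> (\<Union>\<chi>\<in>D. theta_dia n \<chi>))"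
      using rej types_self_satisfied types_extension
      by (intro exI[of _ "types n \<sigma>"] conjI ballI allI impI) simp_all
  next
    assume "\<exists>W \<subseteq> Theta n.
       (\<forall>k\<in>{1..m}. W \<subseteq> {\<phi> i | i. i \<in> I k \<union> J k}) \<and>
       (\<forall>k\<in>{1..m}. \<exists>i\<in>I k. \<phi> i \<in> W) \<and>
       (\<forall>\<psi>\<in>W. sat (model n W) \<psi> \<psi>) \<and>
       (\<forall>D \<subseteq> W. \<exists>\<psi>\<in>W. theta_dia n \<psi> = theta n \<psi> \<union> (\<Union>\<chi>\<in>D. theta_dia n \<chi>))"
    then obtain W where W: "W \<subseteq> Theta n"
      "\<forall>k\<in>{1..m}. W \<subseteq> {\<phi> i | i. i \<in> I k \<union> J k}"
      "\<forall>k\<in>{1..m}. \<exists>i\<in>I k. \<phi> i \<in> W"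
      "\<forall>\<psi>\<in>W. sat (model n W) \<psi> \<psi>"
      "\<forall>D \<subseteq> W. \<exists>\<psi>\<in>W. theta_dia n \<psi> = theta n \<psi> \<union> (\<Union>\<chi>\<in>D. theta_dia n \<chi>)"
      by (elim exE conjE) (rule that; assumption)
    obtain \<sigma> where "types n \<sigma> = W"
      using types_surjective[OF finite_subset[OF W(1) fin] W(1,4,5)] by blast
    then have "\<forall>k\<in>{1..m}. rejects \<sigma> (r k)" using rej W(2,3) by simp
    then show "\<exists>\<sigma>. \<forall>k\<in>{1..m}. rejects \<sigma> (r k)" by (intro exI)
  qed
qed

end
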